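(* Let $G_1,G_2$ be finite simple connected graphs, $G_i$ having $n_i$ vertices and $m_i$ edges. Then the symmetric difference $G_1\oplus G_2$ satisfies \begin{align*} F(G_1\oplus G_2)={}&n_2^4F(G_1)+n_1^4F(G_2)-8F(G_1)F(G_2)+6n_1n_2^2m_2M_1(G_1)+6n_1^2n_2m_1M_1(G_2)\\ &+12n_2F(G_1)M_1(G_2)+12n_1F(G_2)M_1(G_1)-12n_2^2m_2F(G_1)-12n_1^2m_1F(G_2)\\ &-12n_1n_2M_1(G_1)M_1(G_2). \end{align*}
   Context: The symmetric difference $G_1\oplus G_2$ has vertex set $V(G_1)\times V(G_2)$, with $(u_1,u_2)$ adjacent to $(v_1,v_2)$ iff exactly one of the conditions $u_1v_1\in E(G_1)$, $u_2v_2\in E(G_2)$ holds. For a finite simple graph $G$ with vertex degrees $d_G(v)$: $M_1(G)=\sum_{v} d_G(v)^2$ and $F(G)=\sum_{v} d_G(v)^3$. *)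

theory Defs
  imports "Graph_Theory.Graph_Theory"
begin

text \<open>
  A finite simple graph is a \<^locale>\<open>pair_graph\<close>: a finite, loop-free, symmetric relation on a finite
  vertex set. Each undirected edge is represented by two opposite arcs, so the edges proper are the
  unordered pairs below, and the degree of a vertex is its out-degree.
\<close>

definition edges :: "'a pair_pre_digraph \<Rightarrow> 'a set set" where
  "edges G = {{u, v} | u v. (u, v) \<in> parcs G}"

definition degree :: "'a pair_pre_digraph \<Rightarrow> 'a \<Rightarrow> nat" where
  "degree G v = out_degree (with_proj G) v"

definition first_zagreb :: "'a pair_pre_digraph \<Rightarrow> int" where
  "first_zagreb G = (\<Sum>v\<in>pverts G. int (degree G v) ^ 2)"

definition F_index :: "'a pair_pre_digraph \<Rightarrow> int" where
  "F_index G = (\<Sum>v\<in>pverts G. int (degree G v) ^ 3)"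

definition graph_sym_diff ::
  "'a pair_pre_digraph \<Rightarrow> 'b pair_pre_digraph \<Rightarrow> ('a \<times> 'b) pair_pre_digraph" where
  "graph_sym_diff G H =
    \<lparr> pverts = pverts G \<times> pverts H,
      parcs = {((u1, u2), (v1, v2)) | u1 u2 v1 v2.
        u1 \<in> pverts G \<and> v1 \<in> pverts G \<and> u2 \<in> pverts H \<and> v2 \<in> pverts H \<and>
        ((u1, v1) \<in> parcs G) \<noteq> ((u2, v2) \<in> parcs H)} \<rparr>"

lemma pair_graph_graph_sym_diff:
  assumes "pair_graph G" and "pair_graph H"
  shows "pair_graph (graph_sym_diff G H)"
proof -
  interpret G: pair_graph G by fact
  interpret H: pair_graph H by fact
  have sG: "(u, v) \<in> parcs G \<longleftrightarrow> (v, u) \<in> parcs G" for u v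
    using G.pair_sym_arcs by (auto simp: symmetric_def dest: symD)
  have sH: "(u, v) \<in> parcs H \<longleftrightarrow> (v, u) \<in> parcs H" for u v
    using H.pair_sym_arcs by (auto simp: symmetric_def dest: symD)
  have irr: "(u, u) \<notin> parcs G" "(w, w) \<notin> parcs H" for u w
    using G.pair_no_loops H.pair_no_loops by fastforce+
  have sub: "parcs (graph_sym_diff G H) \<subseteq>
      (pverts G \<times> pverts H) \<times> (pverts G \<times> pverts H)"
    by (auto simp: graph_sym_diff_def)
  show ?thesis
  proof
    show "finite (pverts (graph_sym_diff G H))"
      by (simp add: graph_sym_diff_def G.pair_finite_verts H.pair_finite_verts)
    show "finite (parcs (graph_sym_diff G H))"
      by (rule finite_subset[OF sub]) (simp add: G.pair_finite_verts H.pair_finite_verts)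
    show "symmetric (with_proj (graph_sym_diff G H))"
      using sG sH by (auto simp: symmetric_def sym_def graph_sym_diff_def)
  qed (auto simp: graph_sym_diff_def irr)
qed

end

theory Submission
  imports Defs
begin

text \<open>
  A vertex \<open>(u, v)\<close> of the symmetric difference is adjacent to the pairs in
  \<open>N(u) \<times> (V\<^sub>2 - N(v))\<close> and \<open>(V\<^sub>1 - N(u)) \<times> N(v)\<close>, so its degree is
  \<open>n\<^sub>2 d(u) + n\<^sub>1 d(v) - 2 d(u) d(v)\<close>. Cubing this and summing over all pairs splits every
  monomial into a product of power sums of degrees, the first of which is \<open>2 m\<close> by the
  handshake lemma.
\<close>

lemma degree_eq_card_neighbours: "degree G v = card {w. (v, w) \<in> parcs G}"
proof -
  have "out_arcs (with_proj G) v = Pair v ` {w. (v, w) \<in> parcs G}"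
    by (auto simp: out_arcs_def)
  then show ?thesis
    by (simp add: degree_def out_degree_def card_image inj_on_def)
qed

lemma neighbours_subset_pverts:
  assumes "pair_graph G"
  shows "{w. (v, w) \<in> parcs G} \<subseteq> pverts G"
proof -
  interpret pair_graph G by fact
  show ?thesis
    using in_arcsD2 by auto
qed

lemma finite_pverts:
  assumes "pair_graph G"
  shows "finite (pverts G)"
proof -
  interpret pair_graph G by fact
  show ?thesis
    by (rule pair_finite_verts)
qed

lemma sum_degree_eq_card_parcs:
  assumes "pair_graph G"
  shows "(\<Sum>v\<in>pverts G. degree G v) = card (parcs G)"
proof -
  interpret pair_graph G by fact
  have "parcs G = Sigma (pverts G) (\<lambda>v. {w. (v, w) \<in> parcs G})"
    using in_arcsD1 by auto
  moreover have "finite {w. (v, w) \<in> parcs G}" for v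
    using finite_subset[OF neighbours_subset_pverts[OF assms]] pair_finite_verts by auto
  ultimately show ?thesis
    using card_SigmaI[of "pverts G" "\<lambda>v. {w. (v, w) \<in> parcs G}"] pair_finite_verts
    by (simp add: degree_eq_card_neighbours)
qed

lemma card_parcs_eq_twice_card_edges:
  assumes "pair_graph G"
  shows "card (parcs G) = 2 * card (edges G)"
proof -
  interpret pair_graph G by fact
  have symG: "(v, u) \<in> parcs G" if "(u, v) \<in> parcs G" for u v
    using pair_sym_arcs that by (auto simp: symmetric_def dest: symD)
  have irr: "u \<noteq> v" if "(u, v) \<in> parcs G" for u v
    using pair_no_loops that by fastforce
  let ?e = "\<lambda>a. {fst a, snd a}"
  have edges: "edges G = ?e ` parcs G"
    by (force simp: edges_def)
  have fibre: "card {a \<in> parcs G. ?e a = e} = 2" if "e \<in> edges G" for e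
  proof -
    obtain u v where uv: "(u, v) \<in> parcs G" "e = {u, v}"
      using \<open>e \<in> edges G\<close> by (auto simp: edges_def)
    have "{a \<in> parcs G. ?e a = e} = {(u, v), (v, u)}"
      using uv symG by (auto simp: doubleton_eq_iff)
    then show ?thesis
      using irr[OF uv(1)] by simp
  qed
  have "card (parcs G) = (\<Sum>e\<in>edges G. card {a \<in> parcs G. ?e a = e})"
    using sum.image_gen[OF pair_finite_arcs, of "\<lambda>_. 1 :: nat" ?e] by (simp add: edges)
  then show ?thesis
    using fibre by simp
qed

lemma handshake:
  assumes "pair_graph G"
  shows "(\<Sum>v\<in>pverts G. int (degree G v)) = 2 * int (card (edges G))"
proof -
  have "(\<Sum>v\<in>pverts G. int (degree G v)) = int (\<Sum>v\<in>pverts G. degree G v)"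
    by simp
  then show ?thesis
    by (simp only: sum_degree_eq_card_parcs[OF assms] card_parcs_eq_twice_card_edges[OF assms]
        of_nat_mult of_nat_numeral)
qed

lemma pverts_graph_sym_diff: "pverts (graph_sym_diff G H) = pverts G \<times> pverts H"
  by (simp add: graph_sym_diff_def)

lemma degree_graph_sym_diff:
  assumes G: "pair_graph G" and H: "pair_graph H"
    and u: "u \<in> pverts G" and v: "v \<in> pverts H"
  shows "int (degree (graph_sym_diff G H) (u, v)) =
    int (card (pverts H)) * int (degree G u) + int (card (pverts G)) * int (degree H v)
      - 2 * int (degree G u) * int (degree H v)"
proof -
  define A where "A = {w. (u, w) \<in> parcs G}"
  define B where "B = {w. (v, w) \<in> parcs H}"
  note fin = finite_pverts[OF G] finite_pverts[OF H]
  have sub: "A \<subseteq> pverts G" "B \<subseteq> pverts H"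
    unfolding A_def B_def by (rule neighbours_subset_pverts[OF G] neighbours_subset_pverts[OF H])+
  then have finAB: "finite A" "finite B"
    using fin finite_subset by blast+
  have le: "card A \<le> card (pverts G)" "card B \<le> card (pverts H)"
    using sub fin by (auto intro: card_mono)
  have "{w. ((u, v), w) \<in> parcs (graph_sym_diff G H)} =
      A \<times> (pverts H - B) \<union> (pverts G - A) \<times> B"
    using u v sub by (auto simp: graph_sym_diff_def A_def B_def)
  moreover have "card (A \<times> (pverts H - B) \<union> (pverts G - A) \<times> B) =
      card A * (card (pverts H) - card B) + (card (pverts G) - card A) * card B"
    using fin finAB sub
    by (subst card_Un_disjoint) (auto simp: card_cartesian_product card_Diff_subset)
  ultimately have "int (degree (graph_sym_diff G H) (u, v)) =
      int (card A) * (int (card (pverts H)) - int (card B))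
      + (int (card (pverts G)) - int (card A)) * int (card B)"
    using le by (simp add: degree_eq_card_neighbours of_nat_diff)
  then show ?thesis
    by (simp add: degree_eq_card_neighbours A_def B_def algebra_simps)
qed

theorem theorem11:
  fixes G1 :: "'a pair_pre_digraph" and G2 :: "'b pair_pre_digraph"
    and n1 n2 m1 m2 :: int
  assumes "pair_graph G1" and "connected (with_proj G1)"
    and "pair_graph G2" and "connected (with_proj G2)"
    and "n1 = int (card (pverts G1))" and "m1 = int (card (edges G1))"
    and "n2 = int (card (pverts G2))" and "m2 = int (card (edges G2))"
  shows "F_index (graph_sym_diff G1 G2) =
      n2 ^ 4 * F_index G1 + n1 ^ 4 * F_index G2 - 8 * F_index G1 * F_index G2
    + 6 * n1 * n2 ^ 2 * m2 * first_zagreb G1 + 6 * n1 ^ 2 * n2 * m1 * first_zagreb G2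
    + 12 * n2 * F_index G1 * first_zagreb G2 + 12 * n1 * F_index G2 * first_zagreb G1
    - 12 * n2 ^ 2 * m2 * F_index G1 - 12 * n1 ^ 2 * m1 * F_index G2
    - 12 * n1 * n2 * first_zagreb G1 * first_zagreb G2"
proof -
  define a where "a = (\<lambda>u. int (degree G1 u))"
  define b where "b = (\<lambda>v. int (degree G2 v))"
  let ?V = "pverts G1" and ?W = "pverts G2"
  have sums:
    "(\<Sum>u\<in>?V. a u) = 2 * m1" "(\<Sum>v\<in>?W. b v) = 2 * m2"
    "(\<Sum>u\<in>?V. a u ^ 2) = first_zagreb G1" "(\<Sum>v\<in>?W. b v ^ 2) = first_zagreb G2"
    "(\<Sum>u\<in>?V. a u ^ 3) = F_index G1" "(\<Sum>v\<in>?W. b v ^ 3) = F_index G2"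
    using handshake assms by (simp_all add: a_def b_def first_zagreb_def F_index_def)
  have inner: "(\<Sum>v\<in>?W. (n2 * x + n1 * b v - 2 * x * b v) ^ 3) =
      n2 ^ 4 * x ^ 3 + 3 * n2 ^ 2 * x ^ 2 * (n1 - 2 * x) * (2 * m2)
      + 3 * n2 * x * (n1 - 2 * x) ^ 2 * first_zagreb G2
      + (n1 - 2 * x) ^ 3 * F_index G2" for x
  proof -
    have "(\<Sum>v\<in>?W. (n2 * x + n1 * b v - 2 * x * b v) ^ 3) =
      (\<Sum>v\<in>?W. n2 ^ 3 * x ^ 3 + 3 * n2 ^ 2 * x ^ 2 * (n1 - 2 * x) * b v
      + 3 * n2 * x * (n1 - 2 * x) ^ 2 * b v ^ 2 + (n1 - 2 * x) ^ 3 * b v ^ 3)"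
      by (rule sum.cong) (simp_all add: power2_eq_square power3_eq_cube algebra_simps)
    also have "\<dots> = n2 * (n2 ^ 3 * x ^ 3) + 3 * n2 ^ 2 * x ^ 2 * (n1 - 2 * x) * (2 * m2)
      + 3 * n2 * x * (n1 - 2 * x) ^ 2 * first_zagreb G2
      + (n1 - 2 * x) ^ 3 * F_index G2"
      by (simp add: sum.distrib sum_distrib_left[symmetric] sums assms(7)[symmetric])
    finally show ?thesis
      by (simp add: power_numeral_reduce)
  qed
  define c1 where "c1 = 3 * n2 * n1 ^ 2 * first_zagreb G2 - 6 * n1 ^ 2 * F_index G2"
  define c2 where "c2 = 6 * n1 * n2 ^ 2 * m2 - 12 * n1 * n2 * first_zagreb G2 + 12 * n1 * F_index G2"
  define c3 where "c3 = n2 ^ 4 - 12 * n2 ^ 2 * m2 + 12 * n2 * first_zagreb G2 - 8 * F_index G2"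
  have "F_index (graph_sym_diff G1 G2) =
      (\<Sum>(u, v)\<in>?V \<times> ?W. (n2 * a u + n1 * b v - 2 * a u * b v) ^ 3)"
    unfolding F_index_def
    by (rule sum.cong) (auto simp: pverts_graph_sym_diff degree_graph_sym_diff assms a_def b_def)
  also have "\<dots> = (\<Sum>u\<in>?V. \<Sum>v\<in>?W. (n2 * a u + n1 * b v - 2 * a u * b v) ^ 3)"
    by (simp add: sum.cartesian_product)
  also have "\<dots> = (\<Sum>u\<in>?V. n1 ^ 3 * F_index G2 + c1 * a u + c2 * a u ^ 2 + c3 * a u ^ 3)"
    unfolding inner c1_def c2_def c3_def
    by (rule sum.cong) (simp_all add: power2_eq_square power3_eq_cube algebra_simps)
  also have "\<dots> = n1 * (n1 ^ 3 * F_index G2) + c1 * (2 * m1) + c2 * first_zagreb G1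
      + c3 * F_index G1"
    by (simp add: sum.distrib sum_distrib_left[symmetric] sums assms(5)[symmetric])
  finally show ?thesis
    by (simp add: c1_def c2_def c3_def algebra_simps power_numeral_reduce)
qed

end
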